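(* For any integers $n\ge 2$ and $n-1\le m\le n(n-1)$, any graph $\mathbb{G}(n,m)$ constructed by Algorithm 1 (for any admissible choice of the initial directed tree $\mathbb{G}(n,n-1)$) has Laplacian spectrum (as a multiset) consisting of one eigenvalue $0$, together with $(n-1)(\kappa+1)-m$ eigenvalues equal to $\kappa$ and $m-(n-1)\kappa$ eigenvalues equal to $\kappa+1$, where $\kappa=\lfloor \frac{m}{n-1}\rfloor$.
   Context: A directed graph is simple if it has no self-arcs and no multiple arcs with the same tail and head (opposite arcs are allowed). An arc $(j,i)$ goes from tail $j$ to head $i$. The Laplacian matrix of a simple directed graph on vertices $1,\ldots,n$ is $L=D-A$, where $D$ is the diagonal matrix of in-degrees and $A$ has $ij$th entry $1$ if $(j,i)$ is an arc and $0$ otherwise; the Laplacian spectrum is the multiset of eigenvalues of $L$ with algebraic multiplicity. A directed graph is rooted if it has a vertex from which there is a directed path to every other vertex; an $n$-vertex directed tree is a rooted directed graph with $n-1$ arcs. Algorithm 1: Given $n>1$ vertices labeled $1,\ldots,n$. Start with $\mathbb{G}(n,n-1)$ being any directed tree on these vertices such that all its arcs $(i,j)$ satisfy $i<j$. For each integer $m$ with $n\le m\le n(n-1)$, inductively compute $v_{n,m}=n-((m-1)\bmod n)$, let $u_{n,m}$ be the smallest index in $\{1,\ldots,n\}$ such that $u_{n,m}\ne v_{n,m}$ and $(u_{n,m},v_{n,m})$ is not an arc of $\mathbb{G}(n,m-1)$ (such an index exists), and construct $\mathbb{G}(n,m)$ by adding the arc $(u_{n,m},v_{n,m})$ to $\mathbb{G}(n,m-1)$.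 Here $a\bmod b$ is the remainder in $\{0,\ldots,b-1\}$. *)

theory Defs
  imports
    "Graph_Theory.Pair_Digraph"
    "Jordan_Normal_Form.Char_Poly"
    "HOL-Computational_Algebra.Fundamental_Theorem_Algebra"
begin

text \<open>
  A simple directed graph is a \<open>pair_digraph\<close> (finite, loop-free, arcs are pairs
  (tail, head), so there are no multiple arcs but opposite arcs are allowed).
\<close>

definition rooted :: "'a pair_pre_digraph \<Rightarrow> bool" where
  "rooted G \<longleftrightarrow> (\<exists>r \<in> pverts G. \<forall>v \<in> pverts G. r \<rightarrow>\<^sup>*\<^bsub>with_proj G\<^esub> v)"

definition directed_tree :: "'a pair_pre_digraph \<Rightarrow> bool" where
  "directed_tree G \<longleftrightarrow>
     pair_digraph G \<and> rooted G \<and> card (parcs G) = card (pverts G) - 1"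

text \<open>
  The vertices are \<open>1, \<dots>, n\<close> while matrix indices start at \<open>0\<close>, so row and column \<open>i\<close>
  belong to vertex \<open>Suc i\<close>. The entry in row \<open>i\<close>, column \<open>j\<close> of the adjacency matrix refers to
  the arc from (the vertex of) \<open>j\<close> to (the vertex of) \<open>i\<close>.
\<close>

definition in_degree_mat :: "nat \<Rightarrow> nat pair_pre_digraph \<Rightarrow> complex mat" where
  "in_degree_mat n G =
     mat n n (\<lambda>(i, j). if i = j then of_nat (in_degree (with_proj G) (Suc i)) else 0)"

definition adjacency_mat :: "nat \<Rightarrow> nat pair_pre_digraph \<Rightarrow> complex mat" where
  "adjacency_mat n G = mat n n (\<lambda>(i, j). if (Suc j, Suc i) \<in> parcs G then 1 else 0)"

definition laplacian :: "nat \<Rightarrow> nat pair_pre_digraph \<Rightarrow> complex mat" where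
  "laplacian n G = in_degree_mat n G - adjacency_mat n G"

definition laplacian_spectrum :: "nat \<Rightarrow> nat pair_pre_digraph \<Rightarrow> complex multiset" where
  "laplacian_spectrum n G = proots (char_poly (laplacian n G))"

definition next_head :: "nat \<Rightarrow> nat \<Rightarrow> nat" where
  "next_head n m = n - ((m - 1) mod n)"

text \<open>
  If no admissible tail existed, \<open>LEAST\<close> would denote an arbitrary number;
  the existence of one is not assumed anywhere.
\<close>

definition next_tail :: "nat \<Rightarrow> nat \<Rightarrow> nat pair_pre_digraph \<Rightarrow> nat" where
  "next_tail n m G =
     (LEAST u. u \<in> {1..n} \<and> u \<noteq> next_head n m \<and> (u, next_head n m) \<notin> parcs G)"

text \<open>\<open>algorithm1 n m G\<close>: \<open>G\<close> is a possible graph with \<open>m\<close> arcs in a run on \<open>n\<close> vertices.\<close>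

inductive algorithm1 :: "nat \<Rightarrow> nat \<Rightarrow> nat pair_pre_digraph \<Rightarrow> bool" where
  init: "algorithm1 n (n - 1) T"
    if "n > 1" "pverts T = {1..n}" "directed_tree T" "\<And>i j. (i, j) \<in> parcs T \<Longrightarrow> i < j"
| step: "algorithm1 n m (G\<lparr>parcs := insert (next_tail n m G, next_head n m) (parcs G)\<rparr>)"
    if "n \<le> m" "m \<le> n * (n - 1)" "algorithm1 n (m - 1) G"

end

theory Submission
  imports Defs
begin

text \<open>
  Let \<open>N(v)\<close> be the in-neighbourhood of \<open>v\<close> and \<open>d\<close> its size. Throughout the algorithm, \<open>N(v)\<close>
  consists of the \<open>d\<close> smallest vertices other than \<open>v\<close>, except that the largest of them may be
  replaced by the parent \<open>p < v\<close> of \<open>v\<close> in the initial tree. With \<open>k\<close> the in-degree of vertex \<open>1\<close>,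
  all in-degrees are \<open>k\<close> or \<open>k + 1\<close>. Since the rows of the Laplacian sum to zero, subtracting
  row \<open>1\<close> from the other rows and adding all columns to the first one is a similarity
  transformation that clears column \<open>1\<close>. Off the diagonal, the new row of \<open>v\<close> only involves the
  symmetric difference of \<open>N(v)\<close> and \<open>N(1)\<close>, which makes the matrix triangular after a reordering
  of the vertices. The diagonal entries other than the zero of vertex \<open>1\<close> all lie in \<open>{\<kappa>, \<kappa> + 1}\<close>
  and have sum \<open>m\<close>, which determines their multiplicities.
\<close>

section \<open>Matrices that are triangular up to reordering\<close>

text \<open>A permutation with nonzero product never raises \<open>f\<close> and strictly lowers it
  at every moved index, yet permuting leaves the sum of \<open>f\<close> unchanged. So only the
  identity survives in the Leibniz formula.\<close>

lemma det_ranked: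
  fixes A :: "'a :: comm_ring_1 mat" and f :: "nat \<Rightarrow> nat"
  assumes A: "A \<in> carrier_mat n n"
    and rank: "\<And>i j. i < n \<Longrightarrow> j < n \<Longrightarrow> i \<noteq> j \<Longrightarrow> A $$ (i, j) \<noteq> 0 \<Longrightarrow> f j < f i"
  shows "det A = (\<Prod>i = 0..<n. A $$ (i, i))"
proof -
  have zero: "(\<Prod>i = 0..<n. A $$ (i, p i)) = 0" if p: "p permutes {0..<n}" and "p \<noteq> id" for p
  proof (rule ccontr)
    assume "(\<Prod>i = 0..<n. A $$ (i, p i)) \<noteq> 0"
    then have nz: "A $$ (i, p i) \<noteq> 0" if "i \<in> {0..<n}" for i
      using that by (metis finite_atLeastLessThan prod_zero)
    from \<open>p \<noteq> id\<close> obtain i where i: "p i \<noteq> i" by (auto simp: fun_eq_iff)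
    then have "i \<in> {0..<n}" using p by (metis permutes_not_in)
    have lt: "p j \<noteq> j \<Longrightarrow> f (p j) < f j" if "j \<in> {0..<n}" for j
      using that rank[of j "p j"] nz[OF that] permutes_in_image[OF p, of j] by auto
    have "sum (f \<circ> p) {0..<n} < sum f {0..<n}"
    proof (rule sum_strict_mono_ex1)
      show "\<forall>j\<in>{0..<n}. (f \<circ> p) j \<le> f j" using lt by (metis comp_apply order.refl less_imp_le)
      show "\<exists>j\<in>{0..<n}. (f \<circ> p) j < f j"
        using lt[OF \<open>i \<in> {0..<n}\<close> i] \<open>i \<in> {0..<n}\<close> by (metis comp_apply)
    qed simp
    moreover have "sum (f \<circ> p) {0..<n} = sum f {0..<n}"
      using sum.permute[OF p, of f] by simp
    ultimately show False by simp
  qed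
  have "det A = (\<Sum>p\<in>{p. p permutes {0..<n}}. signof p * (\<Prod>i = 0..<n. A $$ (i, p i)))"
    by (rule det_def'[OF A])
  also have "\<dots> = (\<Sum>p\<in>{id}. signof p * (\<Prod>i = 0..<n. A $$ (i, p i)))"
    by (rule sum.mono_neutral_right) (auto simp: zero finite_permutations permutes_id)
  finally show ?thesis by simp
qed

lemma char_poly_ranked:
  fixes A :: "'a :: comm_ring_1 mat" and f :: "nat \<Rightarrow> nat"
  assumes A: "A \<in> carrier_mat n n"
    and rank: "\<And>i j. i < n \<Longrightarrow> j < n \<Longrightarrow> i \<noteq> j \<Longrightarrow> A $$ (i, j) \<noteq> 0 \<Longrightarrow> f j < f i"
  shows "char_poly A = (\<Prod>i = 0..<n. [:- A $$ (i, i), 1:])"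
proof -
  have "det (char_poly_matrix A) = (\<Prod>i = 0..<n. char_poly_matrix A $$ (i, i))"
  proof (rule det_ranked)
    fix i j assume "i < n" "j < n" "i \<noteq> j" "char_poly_matrix A $$ (i, j) \<noteq> 0"
    then show "f j < f i" using A by (intro rank) (auto simp: char_poly_matrix_def)
  qed (use A in simp)
  also have "\<dots> = (\<Prod>i = 0..<n. [:- A $$ (i, i), 1:])"
    using A by (intro prod.cong) (auto simp: char_poly_matrix_def)
  finally show ?thesis by (simp add: char_poly_def)
qed

lemma proots_char_poly_ranked:
  fixes A :: "'a :: idom mat" and f :: "nat \<Rightarrow> nat"
  assumes A: "A \<in> carrier_mat n n"
    and rank: "\<And>i j. i < n \<Longrightarrow> j < n \<Longrightarrow> i \<noteq> j \<Longrightarrow> A $$ (i, j) \<noteq> 0 \<Longrightarrow> f j < f i"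
  shows "proots (char_poly A) = image_mset (\<lambda>i. A $$ (i, i)) (mset_set {0..<n})"
proof -
  have "proots (\<Prod>i\<in>I. [:- A $$ (i, i), 1:]) = image_mset (\<lambda>i. A $$ (i, i)) (mset_set I)"
    if "finite I" for I
    using that
  proof induction
    case (insert i I)
    have "(\<Prod>i\<in>I. [:- A $$ (i, i), 1:]) \<noteq> 0" by (simp add: insert.hyps)
    then have "proots ([:- A $$ (i, i), 1:] * (\<Prod>i\<in>I. [:- A $$ (i, i), 1:])) =
        proots [:- A $$ (i, i), 1:] + proots (\<Prod>i\<in>I. [:- A $$ (i, i), 1:])"
      by (intro proots_mult) auto
    then show ?case using insert by simp
  qed simp
  then show ?thesis using char_poly_ranked[OF A rank] by simp
qed

section \<open>Matrices with zero row sums\<close>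

text \<open>For a matrix with zero row sums, this is its form after replacing the first basis vector
  by the all-ones vector. That vector lies in the kernel, so column 0 is set to zero
  outright.\<close>

definition deflate :: "nat \<Rightarrow> 'a :: comm_ring_1 mat \<Rightarrow> 'a mat" where
  "deflate n A = mat n n (\<lambda>(i, j).
     if j = 0 then 0 else if i = 0 then A $$ (0, j) else A $$ (i, j) - A $$ (0, j))"

lemma char_poly_deflate:
  fixes A :: "'a :: field mat"
  assumes A: "A \<in> carrier_mat n n" and sums: "\<And>i. i < n \<Longrightarrow> (\<Sum>j<n. A $$ (i, j)) = 0"
  shows "char_poly A = char_poly (deflate n A)"
proof -
  \<comment> \<open>\<open>P\<close> performs the row subtractions, its inverse \<open>Q\<close> the
    column additions.\<close>
  define P where "P = mat n n (\<lambda>(i, j). if i = j then 1 else if j = 0 then -1 else (0 :: 'a))"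
  define Q where "Q = mat n n (\<lambda>(i, j). if i = j \<or> j = 0 then 1 else (0 :: 'a))"
  have P: "P \<in> carrier_mat n n" and Q: "Q \<in> carrier_mat n n" by (auto simp: P_def Q_def)
  have PX: "P * X = mat n n (\<lambda>(i, j). if i = 0 then X $$ (0, j) else X $$ (i, j) - X $$ (0, j))"
    if X: "X \<in> carrier_mat n n" for X
  proof (rule eq_matI, goal_cases)
    case (1 i j)
    then have ij: "i < n" "j < n" by auto
    then have "(P * X) $$ (i, j) = (\<Sum>k = 0..<n. P $$ (i, k) * X $$ (k, j))"
      using X P by (auto simp: scalar_prod_def)
    also have "\<dots> = (\<Sum>k\<in>{0, i}. P $$ (i, k) * X $$ (k, j))"
      using ij by (intro sum.mono_neutral_right) (auto simp: P_def)
    also have "\<dots> = (if i = 0 then X $$ (0, j) else X $$ (i, j) - X $$ (0, j))"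
      using ij by (cases "i = 0") (auto simp: P_def)
    finally show ?case using ij by simp
  qed (use X P in auto)
  have XQ: "X * Q = mat n n (\<lambda>(i, j). if j = 0 then \<Sum>k<n. X $$ (i, k) else X $$ (i, j))"
    if X: "X \<in> carrier_mat n n" for X
  proof (rule eq_matI, goal_cases)
    case (1 i j)
    then have ij: "i < n" "j < n" by auto
    then have "(X * Q) $$ (i, j) = (\<Sum>k = 0..<n. X $$ (i, k) * Q $$ (k, j))"
      using X Q by (auto simp: scalar_prod_def)
    also have "\<dots> = (if j = 0 then \<Sum>k<n. X $$ (i, k) else X $$ (i, j))"
    proof (cases "j = 0")
      case True
      then show ?thesis using ij by (auto simp: Q_def atLeast0LessThan intro!: sum.cong)
    next
      case False
      then have "(\<Sum>k = 0..<n. X $$ (i, k) * Q $$ (k, j)) = (\<Sum>k\<in>{j}. X $$ (i, k) * Q $$ (k, j))"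
        using ij by (intro sum.mono_neutral_right) (auto simp: Q_def)
      then show ?thesis using False ij by (simp add: Q_def)
    qed
    finally show ?case using ij by simp
  qed (use X Q in auto)
  have PQ: "P * Q = 1\<^sub>m n" by (subst PX[OF Q]) (auto simp: Q_def)
  have QP: "Q * P = 1\<^sub>m n" by (rule mat_mult_left_right_inverse[OF P Q PQ])
  have "deflate n A = P * (A * Q)"
    using sums by (subst PX) (auto simp: deflate_def XQ[OF A] A Q intro!: eq_matI)
  then have "deflate n A = P * A * Q" using assoc_mult_mat[OF P A Q] by simp
  then have "similar_mat (deflate n A) A"
    by (intro similar_matI[of _ _ P Q n] PQ QP) (use A P Q in \<open>auto simp: deflate_def\<close>)
  then show ?thesis by (simp add: char_poly_similar)
qed

section \<open>In-neighbourhoods and in-degrees in the algorithm\<close>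

definition in_nbrs :: "'a pair_pre_digraph \<Rightarrow> 'a \<Rightarrow> 'a set" where
  "in_nbrs G v = {u. (u, v) \<in> parcs G}"

lemma in_degree_eq_card_in_nbrs: "in_degree (with_proj G) v = card (in_nbrs G v)"
proof -
  have "in_arcs (with_proj G) v = (\<lambda>u. (u, v)) ` in_nbrs G v"
    by (auto simp: in_arcs_def in_nbrs_def)
  then show ?thesis by (simp add: in_degree_def card_image inj_on_def)
qed

definition first_others :: "nat \<Rightarrow> nat \<Rightarrow> nat set" where
  "first_others v d = (if v \<le> d then {1..Suc d} - {v} else {1..d})"

text \<open>In the second form \<open>p\<close> stands for the parent of \<open>v\<close> in the
  initial tree and takes the place of \<open>d\<close>; \<open>p = d\<close> would already be the
  first form.\<close>

definition nbhd_shape :: "nat \<Rightarrow> nat \<Rightarrow> nat set \<Rightarrow> bool" where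
  "nbhd_shape v d N \<longleftrightarrow> N = first_others v d \<or>
     (\<exists>p. 1 \<le> d \<and> d < p \<and> p < v \<and> N = insert p {1..<d})"

lemma nbhd_shape_card: "nbhd_shape v d N \<Longrightarrow> 1 \<le> v \<Longrightarrow> card N = d"
  by (auto simp: nbhd_shape_def first_others_def)

lemma nbhd_shape_irrefl: "nbhd_shape v d N \<Longrightarrow> v \<notin> N"
  by (auto simp: nbhd_shape_def first_others_def split: if_splits)

lemma nbhd_shape_1: "nbhd_shape 1 d N \<Longrightarrow> N = {2..Suc d}"
  by (auto simp: nbhd_shape_def first_others_def)

text \<open>The greedy tail fills the smallest gap, which is the next vertex in order, or
  \<open>d\<close> if the parent had displaced it. The bound \<open>Suc d < n\<close> guarantees
  that a gap exists, so \<open>LEAST\<close> is meaningful.\<close>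

lemma nbhd_shape_insert_Least:
  assumes shape: "nbhd_shape v d N" and v: "v \<in> {1..n}" and d: "Suc d < n"
  defines "u \<equiv> LEAST u. u \<in> {1..n} \<and> u \<noteq> v \<and> u \<notin> N"
  shows "nbhd_shape v (Suc d) (insert u N)" and "u \<in> {1..n}"
proof -
  have least: "u = w" if "w \<in> {1..n}" "w \<noteq> v" "w \<notin> N"
    "\<And>y. y \<in> {1..n} \<Longrightarrow> y \<noteq> v \<Longrightarrow> y \<notin> N \<Longrightarrow> w \<le> y" for w
    unfolding u_def by (rule Least_equality) (use that in auto)
  consider (le) "v \<le> d" "N = {1..Suc d} - {v}" | (eq) "v = Suc d" "N = {1..d}"
    | (gt) "v > Suc d" "N = {1..d}" | (p) p where "1 \<le> d" "d < p" "p < v" "N = insert p {1..<d}"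
    using shape unfolding nbhd_shape_def first_others_def
    by (metis Suc_lessI not_less)
  then have "nbhd_shape v (Suc d) (insert u N) \<and> u \<in> {1..n}"
  proof cases
    case le
    then have "u = Suc (Suc d)" using v d by (intro least) auto
    then show ?thesis using le v d by (auto simp: nbhd_shape_def first_others_def)
  next
    case eq
    then have "u = Suc (Suc d)" using v d by (intro least) (auto simp: not_less_eq_eq)
    then show ?thesis using eq v d by (auto simp: nbhd_shape_def first_others_def)
  next
    case gt
    then have "u = Suc d" using v d by (intro least) (auto simp: not_less_eq_eq)
    then show ?thesis using gt v d by (auto simp: nbhd_shape_def first_others_def)
  next
    case p
    then have u: "u = d" using v d by (intro least) auto
    then have N: "insert u N = insert p {1..<Suc d}"
      using p by (simp add: atLeastLessThanSuc insert_commute)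
    \<comment> \<open>Here the parent has become the next vertex in order, and the exceptional form
      merges into the regular one.\<close>
    have "insert u N = first_others v (Suc d)" if "p = Suc d"
      unfolding N using that p
      by (simp add: first_others_def atLeastLessThanSuc_atLeastAtMost atLeastAtMostSuc_conv)
    moreover have "1 \<le> Suc d \<and> Suc d < p \<and> p < v \<and> insert u N = insert p {1..<Suc d}"
      if "p \<noteq> Suc d"
      using that p N by simp
    ultimately have "nbhd_shape v (Suc d) (insert u N)" unfolding nbhd_shape_def by blast
    then show ?thesis using u p v by simp
  qed
  then show "nbhd_shape v (Suc d) (insert u N)" and "u \<in> {1..n}" by auto
qed

text \<open>The in-degree of \<open>v\<close> after \<open>m\<close> arcs: heads run cyclically
  through n, ..., 1, and the tree arcs count as the first n - 1 steps, having heads n, ...,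
  2.\<close>

definition alg_degree :: "nat \<Rightarrow> nat \<Rightarrow> nat \<Rightarrow> nat" where
  "alg_degree n m v = m div n + (if n - m mod n < v then 1 else 0)"

lemma alg_degree_Suc:
  assumes "v \<in> {1..n}"
  shows "alg_degree n (Suc m) v = alg_degree n m v + (if v = next_head n (Suc m) then 1 else 0)"
proof -
  have "m mod n < n" using assms by auto
  then show ?thesis using assms
    by (auto simp: alg_degree_def next_head_def mod_Suc div_Suc)
qed

lemma alg_degree_next_head: "alg_degree n m (next_head n (Suc m)) = m div n"
  by (simp add: alg_degree_def next_head_def)

text \<open>Arcs increase, so vertex 1 has no in-arc and must be the root. Each other vertex needs
  an in-arc to be reached, and these account for all n - 1 arcs.\<close>

lemma tree_in_nbrs:
  fixes T :: "nat pair_pre_digraph"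
  assumes verts: "pverts T = {1..n}" and tree: "directed_tree T"
    and less: "\<And>i j. (i, j) \<in> parcs T \<Longrightarrow> i < j"
  shows "in_nbrs T 1 = {}" and "v \<in> {2..n} \<Longrightarrow> \<exists>p. 1 \<le> p \<and> p < v \<and> in_nbrs T v = {p}"
proof -
  from tree interpret pair_digraph T by (simp add: directed_tree_def)
  have arcs: "1 \<le> i" "j \<le> n" if "(i, j) \<in> parcs T" for i j
    using in_arcsD1[OF that] in_arcsD2[OF that] verts by auto
  have no1: "(u, 1) \<notin> parcs T" for u using arcs(1)[of u 1] less[of u 1] by auto
  then show "in_nbrs T 1 = {}" by (simp add: in_nbrs_def)
  from tree obtain r where "r \<in> pverts T"
    and reach: "\<And>v. v \<in> pverts T \<Longrightarrow> (r, v) \<in> rtrancl_on (pverts T) (parcs T)"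
    by (auto simp: directed_tree_def rooted_def reachable_def)
  have arc_to: "\<exists>u. (u, v) \<in> parcs T" if "v \<in> pverts T" "v \<noteq> r" for v
    using reach[OF that(1)] that(2) by cases auto
  have "1 \<in> pverts T" using \<open>r \<in> pverts T\<close> verts by auto
  then have "r = 1" using arc_to no1 by blast
  then have "\<exists>u. (u, v) \<in> parcs T" if "v \<in> {2..n}" for v
    using arc_to[of v] that verts by auto
  then obtain p where p: "\<And>v. v \<in> {2..n} \<Longrightarrow> (p v, v) \<in> parcs T" by metis
  have "card ((\<lambda>v. (p v, v)) ` {2..n}) = n - 1"
    by (subst card_image) (auto simp: inj_on_def)
  then have arcs_eq: "parcs T = (\<lambda>v. (p v, v)) ` {2..n}"
    using p tree verts pair_finite_arcs
    by (intro card_subset_eq[symmetric]) (auto simp: directed_tree_def)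
  assume v: "v \<in> {2..n}"
  have "in_nbrs T v = {p v}" using v by (auto simp: in_nbrs_def arcs_eq)
  then show "\<exists>p. 1 \<le> p \<and> p < v \<and> in_nbrs T v = {p}"
    using arcs(1)[OF p[OF v]] less[OF p[OF v]] by auto
qed

lemma algorithm1_invariant:
  assumes "algorithm1 n m G"
  shows "1 < n \<and> parcs G \<subseteq> {1..n} \<times> {1..n} \<and>
    (\<forall>v\<in>{1..n}. nbhd_shape v (alg_degree n m v) (in_nbrs G v))"
  using assms
proof induction
  case (init n T)
  then interpret pair_digraph T by (simp add: directed_tree_def)
  have "parcs T \<subseteq> {1..n} \<times> {1..n}"
    using in_arcsD1 in_arcsD2 init(2) by auto
  moreover have "nbhd_shape v (alg_degree n (n - 1) v) (in_nbrs T v)" if v: "v \<in> {1..n}" for v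
  proof (cases "v = 1")
    case True
    then show ?thesis using tree_in_nbrs(1)[OF init(2-4)] init(1)
      by (auto simp: nbhd_shape_def first_others_def alg_degree_def)
  next
    case False
    then obtain p where p: "1 \<le> p" "p < v" "in_nbrs T v = {p}"
      using tree_in_nbrs(2)[OF init(2-4), of v] v by auto
    have "alg_degree n (n - 1) v = 1" using False v init(1) by (auto simp: alg_degree_def)
    \<comment> \<open>At degree 1, the parent 1 gives the regular form; any other parent gives the
      exceptional one, with \<open>{1..<1}\<close> empty.\<close>
    then show ?thesis using p by (cases "p = 1") (auto simp: nbhd_shape_def first_others_def)
  qed
  ultimately show ?case using init by blast
next
  case (step n m G)
  then obtain l where m: "m = Suc l" by (cases m) auto
  define h where "h = next_head n m"
  define t where "t = next_tail n m G"
  from step have n: "1 < n" and sub: "parcs G \<subseteq> {1..n} \<times> {1..n}"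
    and shape: "\<And>v. v \<in> {1..n} \<Longrightarrow> nbhd_shape v (alg_degree n l v) (in_nbrs G v)"
    by (auto simp: m)
  have h: "h \<in> {1..n}" using n by (auto simp: h_def next_head_def less_Suc_eq_le[symmetric] Suc_diff_Suc)
  have deg: "alg_degree n l h = l div n" by (simp add: h_def m alg_degree_next_head)
  \<comment> \<open>The head has in-degree below n - 1 before the arc is added, so an admissible
    tail exists.\<close>
  have "l < n * (n - 1)" using step.hyps m by simp
  then have "l div n < n - 1" using n by (simp add: less_mult_imp_div_less mult.commute)
  then have "Suc (alg_degree n l h) < n" using deg by simp
  note new = nbhd_shape_insert_Least[OF shape[OF h] h this]
  have t_eq: "t = (LEAST u. u \<in> {1..n} \<and> u \<noteq> h \<and> u \<notin> in_nbrs G h)"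
    by (simp add: t_def h_def next_tail_def in_nbrs_def)
  have nbrs: "in_nbrs (G\<lparr>parcs := insert (t, h) (parcs G)\<rparr>) v =
      (if v = h then insert t (in_nbrs G h) else in_nbrs G v)" for v
    by (auto simp: in_nbrs_def)
  have "nbhd_shape v (alg_degree n m v) (in_nbrs (G\<lparr>parcs := insert (t, h) (parcs G)\<rparr>) v)"
    if v: "v \<in> {1..n}" for v
    unfolding nbrs using new(1)[folded t_eq] shape[OF v] alg_degree_Suc[OF v, of l]
    by (simp add: m[symmetric] h_def[symmetric])
  then show ?case using n sub h new(2) unfolding t_eq[symmetric]
    by (auto simp: h_def[symmetric] t_def[symmetric])
qed

section \<open>The spectrum\<close>

lemma laplacian_index:
  assumes "i < n" "j < n"
  shows "laplacian n G $$ (i, j) = (if i = j then of_nat (card (in_nbrs G (Suc i))) else 0) -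
    (if Suc j \<in> in_nbrs G (Suc i) then 1 else 0)"
  using assms by (auto simp: laplacian_def in_degree_mat_def adjacency_mat_def
      in_degree_eq_card_in_nbrs in_nbrs_def)

lemma laplacian_carrier: "laplacian n G \<in> carrier_mat n n"
  by (auto simp: laplacian_def in_degree_mat_def adjacency_mat_def)

lemma laplacian_row_sum:
  assumes sub: "in_nbrs G (Suc i) \<subseteq> {1..n}" and i: "i < n"
  shows "(\<Sum>j<n. laplacian n G $$ (i, j)) = 0"
proof -
  have "(\<Sum>j<n. if Suc j \<in> in_nbrs G (Suc i) then 1 else 0 :: complex)
      = of_nat (card {j\<in>{..<n}. Suc j \<in> in_nbrs G (Suc i)})"
    by (subst sum.inter_filter[symmetric]) auto
  also have "card {j\<in>{..<n}. Suc j \<in> in_nbrs G (Suc i)} = card (in_nbrs G (Suc i))"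
  proof (rule bij_betw_same_card[of Suc], rule bij_betwI[where g = "\<lambda>u. u - 1"])
    show "(\<lambda>u. u - 1) \<in> in_nbrs G (Suc i) \<rightarrow> {j\<in>{..<n}. Suc j \<in> in_nbrs G (Suc i)}"
      using sub by force
  qed (use sub in auto)
  finally show ?thesis using i by (simp add: laplacian_index sum_subtractf)
qed

text \<open>
  Only a vertex \<open>v \<le> k + 1\<close> of degree \<open>k + 1\<close> produces an entry above the diagonal, and then
  always in the column of \<open>k + 2\<close>, whose own row has no entry off the diagonal.
\<close>

lemma nbhd_shape_symdiff:
  assumes "nbhd_shape v d N" "d = k \<or> d = Suc k" "2 \<le> v" "2 \<le> u" "u \<noteq> v"
    and "u \<in> N \<longleftrightarrow> u \<notin> {2..Suc k}"
  shows "u < v \<and> \<not> (v = k + 2 \<and> d = Suc k) \<or> u = k + 2 \<and> v \<le> Suc k \<and> d = Suc k"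
  using assms by (auto simp: nbhd_shape_def first_others_def split: if_splits)

text \<open>With two consecutive values, the cardinality and the sum determine both
  multiplicities.\<close>

lemma image_mset_two_values:
  fixes e :: "'a \<Rightarrow> nat"
  assumes "finite A" "\<And>x. x \<in> A \<Longrightarrow> e x = c \<or> e x = c + 1"
  shows "image_mset e (mset_set A) = replicate_mset (card A * (c + 1) - sum e A) c +
    replicate_mset (sum e A - card A * c) (c + 1)"
proof -
  \<comment> \<open>The bounds are carried through the induction because the multiplicities use
    truncated subtraction.\<close>
  have "card A * c \<le> sum e A \<and> sum e A \<le> card A * (c + 1) \<and> ?thesis"
    using assms
  proof induction
    case (insert x A)
    then have IH: "card A * c \<le> sum e A" "sum e A \<le> card A * (c + 1)"
      "image_mset e (mset_set A) = replicate_mset (card A * (c + 1) - sum e A) c +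
        replicate_mset (sum e A - card A * c) (c + 1)" by auto
    from insert.prems have "e x = c \<or> e x = c + 1" by simp
    then show ?case
    proof
      assume ex: "e x = c"
      have "card (insert x A) * (c + 1) - sum e (insert x A) = Suc (card A * (c + 1) - sum e A)"
        "sum e (insert x A) - card (insert x A) * c = sum e A - card A * c"
        using insert.hyps ex IH(1,2) by auto
      then show ?thesis using insert.hyps ex IH by simp
    next
      assume ex: "e x = c + 1"
      have "card (insert x A) * (c + 1) - sum e (insert x A) = card A * (c + 1) - sum e A"
        "sum e (insert x A) - card (insert x A) * c = Suc (sum e A - card A * c)"
        using insert.hyps ex IH(1,2) by auto
      then show ?thesis using insert.hyps ex IH by simp
    qed
  qed simp
  then show ?thesis by blast
qed

text \<open>These are the diagonal entries after deflation. The extra 1 for small \<open>i\<close>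
  comes from subtracting the entry -1 that the arc from vertex i + 1 to vertex 1 has in row
  0.\<close>

lemma laplacian_spectrum_diagonal:
  assumes "algorithm1 n m G"
  shows "laplacian_spectrum n G = {#0#} + image_mset of_nat
    (image_mset (\<lambda>i. alg_degree n m (Suc i) + (if i \<le> m div n then 1 else 0)) (mset_set {1..<n}))"
proof -
  define k where "k = m div n"
  define L where "L = laplacian n G"
  define B where "B = deflate n L"
  define d where "d = alg_degree n m"
  from algorithm1_invariant[OF assms] have n: "1 < n" and sub: "parcs G \<subseteq> {1..n} \<times> {1..n}"
    and shape: "\<And>v. v \<in> {1..n} \<Longrightarrow> nbhd_shape v (d v) (in_nbrs G v)"
    by (auto simp: d_def)
  have "m mod n < n" using n by simp
  then have d1: "d 1 = k" by (auto simp: d_def k_def alg_degree_def)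
  have d_cases: "d v = k \<or> d v = Suc k" for v by (simp add: d_def k_def alg_degree_def)
  have d_mono: "d v \<le> d w" if "v \<le> w" for v w
    using that by (auto simp: d_def alg_degree_def)
  have nbrs1: "in_nbrs G (Suc 0) = {2..Suc k}" using shape[of 1] nbhd_shape_1 d1 n by simp
  have card: "card (in_nbrs G v) = d v" if "v \<in> {1..n}" for v
    using nbhd_shape_card[OF shape[OF that]] that by simp
  have irrefl: "v \<notin> in_nbrs G v" if "v \<in> {1..n}" for v
    using nbhd_shape_irrefl[OF shape[OF that]] .
  \<comment> \<open>Row 0 may be full but column 0 vanishes, so index 0 goes on top. Index
    \<open>Suc k\<close>, vertex k + 2, drops to the bottom when its row is diagonal.\<close>
  define rank where "rank i = (if i = 0 then n else if i = Suc k \<and> d (k + 2) = Suc k then 0 else i)"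
    for i
  have B: "B \<in> carrier_mat n n" by (simp add: B_def deflate_def)
  have diag: "B $$ (i, i) = of_nat (d (Suc i) + (if i \<le> k then 1 else 0))" if "i \<in> {1..<n}" for i
    using that n irrefl[of "Suc i"] card[of "Suc i"]
    by (auto simp: B_def L_def deflate_def laplacian_index nbrs1)
  have ranked: "rank j < rank i" if "i < n" "j < n" "i \<noteq> j" "B $$ (i, j) \<noteq> 0" for i j
  proof (cases "i = 0")
    case True
    then show ?thesis using that by (auto simp: rank_def)
  next
    case False
    have "j \<noteq> 0" using that by (auto simp: B_def deflate_def split: if_splits)
    \<comment> \<open>Off the diagonal, the difference of two 0/1 indicators is nonzero exactly when
      the memberships differ.\<close>
    have "Suc j \<in> in_nbrs G (Suc i) \<longleftrightarrow> Suc j \<notin> {2..Suc k}"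
      using that False \<open>j \<noteq> 0\<close>
      by (auto simp: B_def deflate_def L_def laplacian_index nbrs1 split: if_splits)
    then have "Suc j < Suc i \<and> \<not> (Suc i = k + 2 \<and> d (Suc i) = Suc k) \<or>
        Suc j = k + 2 \<and> Suc i \<le> Suc k \<and> d (Suc i) = Suc k"
      using that False \<open>j \<noteq> 0\<close> d_cases[of "Suc i"] by (intro nbhd_shape_symdiff[OF shape]) auto
    then show ?thesis
    proof
      assume "Suc j < Suc i \<and> \<not> (Suc i = k + 2 \<and> d (Suc i) = Suc k)"
      then show ?thesis using False \<open>j \<noteq> 0\<close> by (auto simp: rank_def)
    next
      assume *: "Suc j = k + 2 \<and> Suc i \<le> Suc k \<and> d (Suc i) = Suc k"
      \<comment> \<open>Degrees grow with the vertex label, so vertex k + 2 also has degree k + 1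
        and the exceptional rank applies.\<close>
      then have "d (k + 2) = Suc k" using d_mono[of "Suc i" "k + 2"] d_cases[of "k + 2"] by auto
      then show ?thesis using * False by (auto simp: rank_def)
    qed
  qed
  have "char_poly L = char_poly B"
    unfolding B_def L_def
    by (rule char_poly_deflate[OF laplacian_carrier laplacian_row_sum])
      (use sub in \<open>auto simp: in_nbrs_def\<close>)
  then have "laplacian_spectrum n G = image_mset (\<lambda>i. B $$ (i, i)) (mset_set {0..<n})"
    using proots_char_poly_ranked[OF B ranked] by (simp add: laplacian_spectrum_def L_def)
  also have "{0..<n} = insert 0 {1..<n}" using n by auto
  also have "image_mset (\<lambda>i. B $$ (i, i)) (mset_set (insert 0 {1..<n})) =
      {#0#} + image_mset (\<lambda>i. B $$ (i, i)) (mset_set {1..<n})"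
    using n by (simp add: B_def deflate_def)
  also have "image_mset (\<lambda>i. B $$ (i, i)) (mset_set {1..<n}) =
      image_mset (\<lambda>i. of_nat (d (Suc i) + (if i \<le> k then 1 else 0))) (mset_set {1..<n})"
    by (rule image_mset_cong) (simp add: diag)
  finally show ?thesis by (simp add: d_def k_def image_mset.compositionality comp_def)
qed

theorem theorem3:
  fixes n m \<kappa> :: nat and G :: "nat pair_pre_digraph"
  assumes "n \<ge> 2" and "n - 1 \<le> m" and "m \<le> n * (n - 1)"
    and "algorithm1 n m G"
    and "\<kappa> = m div (n - 1)"
  shows "laplacian_spectrum n G =
    {#0#} + replicate_mset ((n - 1) * (\<kappa> + 1) - m) (of_nat \<kappa>)
          + replicate_mset (m - (n - 1) * \<kappa>) (of_nat (\<kappa> + 1))"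
proof -
  define q where "q = m div n"
  define r where "r = m mod n"
  define e where "e i = alg_degree n m (Suc i) + (if i \<le> q then 1 else 0)" for i
  have r: "r < n" using assms(1) by (simp add: r_def)
  have m: "m = n * q + r" by (simp add: q_def r_def)
  \<comment> \<open>This turns division by n into division by n - 1, leaving only q + r to be
    divided.\<close>
  have m': "m = q * (n - 1) + (q + r)"
    using assms(1) by (cases n) (auto simp: m algebra_simps)
  have "q \<le> (n * (n - 1)) div n" unfolding q_def by (rule div_le_mono[OF assms(3)])
  then have q: "q \<le> n - 1" using assms(1) by simp
  \<comment> \<open>Otherwise q = r = n - 1, and m would exceed n(n - 1).\<close>
  have qr: "q + r < 2 * (n - 1)"
  proof (rule ccontr)
    assume "\<not> q + r < 2 * (n - 1)"
    then have "q = n - 1" "r = n - 1" using q r by auto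
    then show False using assms(1,3) m by simp
  qed
  have e: "e i = q + (if n - r \<le> i then 1 else 0) + (if i \<le> q then 1 else 0)" for i
    by (simp add: e_def alg_degree_def q_def r_def less_Suc_eq_le)
  have \<kappa>: "\<kappa> = q + (if q + r < n - 1 then 0 else 1)"
  proof -
    have "m div (n - 1) = q + (q + r) div (n - 1)" using assms(1) by (simp add: m')
    moreover have "(q + r) div (n - 1) = (if q + r < n - 1 then 0 else 1)"
      using qr by (auto intro!: div_nat_eqI)
    ultimately show ?thesis by (simp add: assms(5))
  qed
  \<comment> \<open>The ranges i \<ge> n - r and i \<le> q are disjoint if q + r < n - 1 and cover
    \<open>{1..<n}\<close> otherwise.\<close>
  have two_values: "e i = \<kappa> \<or> e i = \<kappa> + 1" if "i \<in> {1..<n}" for i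
    using that q r by (auto simp: e \<kappa>)
  \<comment> \<open>The ranges have sizes r and q, so the total is (n - 1)q + r + q = m.\<close>
  have "sum e {1..<n} = (n - 1) * q + (\<Sum>i\<in>{1..<n}. if n - r \<le> i then 1 else 0)
      + (\<Sum>i\<in>{1..<n}. if i \<le> q then 1 else 0)"
    by (simp add: e sum.distrib)
  also have "(\<Sum>i\<in>{1..<n}. if n - r \<le> i then 1 else 0) = card {n - r..<n}"
  proof -
    have "{i \<in> {1..<n}. n - r \<le> i} = {n - r..<n}" using r by auto
    then show ?thesis by (simp flip: sum.inter_filter)
  qed
  also have "(\<Sum>i\<in>{1..<n}. if i \<le> q then 1 else 0) = card {1..q}"
  proof -
    have "{i \<in> {1..<n}. i \<le> q} = {1..q}" using q assms(1) by auto
    then show ?thesis by (simp flip: sum.inter_filter)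
  qed
  finally have "sum e {1..<n} = m" using r by (simp add: m' mult.commute)
  then have "image_mset e (mset_set {1..<n}) = replicate_mset ((n - 1) * (\<kappa> + 1) - m) \<kappa> +
      replicate_mset (m - (n - 1) * \<kappa>) (\<kappa> + 1)"
    using image_mset_two_values[of "{1..<n}" e \<kappa>] two_values by simp
  then show ?thesis
    using laplacian_spectrum_diagonal[OF assms(4)]
    by (simp add: e_def[abs_def, symmetric] q_def[symmetric] add.assoc)
qed

end
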